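(* Let $a,b,c,d$ be mutually co-prime odd positive integers such that $b$ and $d$ are square-free, and $a$ and $c$ are cube-free. Let $\{p_1,\ldots,p_k\}$ be the collection of all the prime divisors of $ab$ and let $P_i$ be the Sylow $p_i$-subgroup of $\mathbb Z_{ab}\times\mathbb Z_b$, of order $p_i^{\alpha_i}$ where $\alpha_i\in\{1,2\}$. Let $\mathcal S_{P_i,(cd,d)}$ be the class of split extensions of $P_i$ by $\mathbb Z_{cd}\times\mathbb Z_d$. Let $f_{\mathcal S}(ab^2cd^2)$ denote the number of isomorphism classes of groups in $\mathcal S = \mathcal S_{(ab,b),(cd,d)}$, the set of split extensions of $\mathbb Z_{ab}\times\mathbb Z_b$ by $\mathbb Z_{cd}\times\mathbb Z_d$. Let $f_{\mathcal S_{P_i,(cd,d)}}(p_i^{\alpha_i}cd^2)$ denote the number of isomorphism classes of split extensions of $P_i$ by $\mathbb Z_{cd}\times\mathbb Z_d$. Then $$f_{\mathcal S}(ab^2cd^2) \geq \prod_{i=1}^{k} f_{\mathcal S_{P_i,(cd,d)}}(p_i^{\alpha_i}cd^2).$$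
   Context: An integer is cube-free (square-free) if it is not divisible by the cube (square) of any prime. A split extension of $P$ by $Q$ is a semidirect product $P\rtimes_\theta Q$ with normal subgroup $P$, for a homomorphism $\theta: Q\to\mathrm{Aut}(P)$, where $\theta_x(a)=xax^{-1}$ for $x\in Q$, $a\in P$. *)

theory Defs
  imports "HOL-Algebra.Bij" "HOL-Algebra.Elementary_Groups" "HOL-Computational_Algebra.Squarefree"
begin

definition cube_free :: "nat \<Rightarrow> bool" where
  "cube_free n \<longleftrightarrow> (\<forall>p. prime p \<longrightarrow> \<not> p ^ 3 dvd n)"

text \<open>
  The group of pairs \<open>a x\<close> with \<open>a \<in> P\<close>, \<open>x \<in> Q\<close> and \<open>x a x\<^sup>-\<^sup>1 = \<theta>\<^sub>x(a)\<close>, so that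
  \<open>(a x) (b y) = (a \<theta>\<^sub>x(b)) (x y)\<close>.
\<close>

definition semidirect ::
  "('a, 'm) monoid_scheme \<Rightarrow> ('b, 'n) monoid_scheme \<Rightarrow> ('b \<Rightarrow> 'a \<Rightarrow> 'a) \<Rightarrow> ('a \<times> 'b) monoid" where
  "semidirect P Q \<theta> =
    \<lparr>carrier = carrier P \<times> carrier Q,
     monoid.mult = (\<lambda>(a, x) (b, y). (a \<otimes>\<^bsub>P\<^esub> \<theta> x b, x \<otimes>\<^bsub>Q\<^esub> y)),
     one = (\<one>\<^bsub>P\<^esub>, \<one>\<^bsub>Q\<^esub>)\<rparr>"

definition split_extensions ::
  "('a, 'm) monoid_scheme \<Rightarrow> ('b, 'n) monoid_scheme \<Rightarrow> ('a \<times> 'b) monoid set" where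
  "split_extensions P Q = {semidirect P Q \<theta> | \<theta>. \<theta> \<in> hom Q (AutoGroup P)}"

text \<open>
  The number \<open>f\<^sub>S(n)\<close> of isomorphism classes of groups of order \<open>n\<close> in a class \<open>S\<close>.
  For \<open>S\<close> the split extensions of one finite group by another this is the cardinality of a
  finite quotient, even though a homomorphism \<open>\<theta>\<close> is unconstrained outside the carrier of
  its domain: homomorphisms that agree on the carrier give isomorphic groups.
\<close>

definition num_iso_classes :: "'a monoid set \<Rightarrow> nat \<Rightarrow> nat" where
  "num_iso_classes S n =
    (let A = {G \<in> S. order G = n} in card (A // {(G, H) \<in> A \<times> A. G \<cong> H}))"

definition sylow_subgroup :: "nat \<Rightarrow> 'a set \<Rightarrow> ('a, 'm) monoid_scheme \<Rightarrow> bool" where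
  "sylow_subgroup p H G \<longleftrightarrow> subgroup H G \<and> card H = p ^ multiplicity p (order G)"

end

theory Submission
  imports Defs "HOL-Algebra.Multiplicative_Group" "HOL-Number_Theory.Cong"
begin

text \<open>
  Let \<open>P\<close> be a finite abelian group that is the product of subgroups \<open>H i\<close> of pairwise coprime
  orders, and let \<open>Q\<close> be a finite group whose order is coprime to that of \<open>P\<close>. Actions \<open>\<theta> i\<close> of \<open>Q\<close>
  on the factors combine to an action of \<open>Q\<close> on \<open>P\<close> (\<open>glue_in_hom\<close>). The inequality holds because
  the isomorphism class of the resulting extension \<open>G\<close> of \<open>P\<close> by \<open>Q\<close> determines the isomorphism
  class of every extension \<open>G i\<close> of \<open>H i\<close> by \<open>Q\<close> defined by \<open>\<theta> i\<close>.

  To recover \<open>G i\<close> from \<open>G\<close>, project \<open>P\<close> to \<open>H i\<close> and leave the \<open>Q\<close> component alone. This maps \<open>G\<close>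
  onto \<open>G i\<close> with kernel \<open>N i\<close>, the product of the other factors. With \<open>m\<close> the order of \<open>N i\<close>, the
  order of \<open>G i\<close> is coprime to \<open>m\<close>, so \<open>N i\<close> is exactly the set of elements of \<open>G\<close> whose \<open>m\<close>-th
  power is trivial (\<open>semidirect_proj_kernel\<close>). That description refers only to the group structure
  of \<open>G\<close>. Hence an isomorphism between two such extensions carries one kernel onto the other, and the
  quotients are isomorphic (\<open>torsion_quotient_iso\<close>).

  So gluing one representative per factor gives an injection from tuples of isomorphism classes to
  isomorphism classes of extensions of \<open>P\<close> by \<open>Q\<close> (\<open>prod_num_iso_classes_le\<close>). For the product of
  two cyclic groups in question the \<open>H i\<close> are the Sylow subgroups.
\<close>

section \<open>Split extensions\<close>

lemma AutoGroup_simps: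
  "carrier (AutoGroup P) = auto P"
  "f \<in> auto P \<Longrightarrow> g \<in> auto P \<Longrightarrow> f \<otimes>\<^bsub>AutoGroup P\<^esub> g = compose (carrier P) f g"
  by (auto simp: AutoGroup_def BijGroup_def auto_def)

locale action_by_automorphisms = P: group P + Q: group Q
  for P :: "('a, 'm) monoid_scheme" and Q :: "('b, 'n) monoid_scheme" and \<theta> +
  assumes hom_Aut: "\<theta> \<in> hom Q (AutoGroup P)"
begin

lemma act_auto: "x \<in> carrier Q \<Longrightarrow> \<theta> x \<in> auto P"
  using hom_Aut by (auto simp: hom_def AutoGroup_simps)

lemma act_closed [simp]: "x \<in> carrier Q \<Longrightarrow> a \<in> carrier P \<Longrightarrow> \<theta> x a \<in> carrier P"
  using act_auto by (auto simp: auto_def hom_def)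

lemma act_mult:
  "x \<in> carrier Q \<Longrightarrow> a \<in> carrier P \<Longrightarrow> b \<in> carrier P \<Longrightarrow> \<theta> x (a \<otimes>\<^bsub>P\<^esub> b) = \<theta> x a \<otimes>\<^bsub>P\<^esub> \<theta> x b"
  using act_auto by (auto simp: auto_def hom_def)

lemma act_group_hom: "x \<in> carrier Q \<Longrightarrow> group_hom P P (\<theta> x)"
  by unfold_locales (auto simp: hom_def act_mult)

lemma act_comp:
  assumes "x \<in> carrier Q" "y \<in> carrier Q" "a \<in> carrier P"
  shows "\<theta> (x \<otimes>\<^bsub>Q\<^esub> y) a = \<theta> x (\<theta> y a)"
proof -
  have "\<theta> (x \<otimes>\<^bsub>Q\<^esub> y) = compose (carrier P) (\<theta> x) (\<theta> y)"
    using assms hom_mult[OF hom_Aut] act_auto by (simp add: AutoGroup_simps)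
  then show ?thesis using assms by (simp add: compose_def)
qed

lemma act_one [simp]:
  assumes "a \<in> carrier P" shows "\<theta> \<one>\<^bsub>Q\<^esub> a = a"
proof -
  have "\<theta> \<one>\<^bsub>Q\<^esub> = \<one>\<^bsub>AutoGroup P\<^esub>"
    by (rule hom_one[OF hom_Aut Q.is_group P.AutoGroup])
  then show ?thesis using assms by (simp add: AutoGroup_def BijGroup_def)
qed

lemma group_semidirect: "group (semidirect P Q \<theta>)"
proof (rule groupI)
  fix g assume "g \<in> carrier (semidirect P Q \<theta>)"
  then obtain a x where g: "g = (a, x)" "a \<in> carrier P" "x \<in> carrier Q"
    by (auto simp: semidirect_def)
  have "\<theta> (inv\<^bsub>Q\<^esub> x) (inv\<^bsub>P\<^esub> a) \<otimes>\<^bsub>P\<^esub> \<theta> (inv\<^bsub>Q\<^esub> x) a = \<theta> (inv\<^bsub>Q\<^esub> x) (inv\<^bsub>P\<^esub> a \<otimes>\<^bsub>P\<^esub> a)"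
    by (rule act_mult[symmetric]) (use g in auto)
  also have "\<dots> = \<one>\<^bsub>P\<^esub>"
    using g group_hom.hom_one[OF act_group_hom] by simp
  finally show "\<exists>h\<in>carrier (semidirect P Q \<theta>). h \<otimes>\<^bsub>semidirect P Q \<theta>\<^esub> g = \<one>\<^bsub>semidirect P Q \<theta>\<^esub>"
    using g by (intro bexI[of _ "(\<theta> (inv\<^bsub>Q\<^esub> x) (inv\<^bsub>P\<^esub> a), inv\<^bsub>Q\<^esub> x)"]) (auto simp: semidirect_def)
qed (auto simp: semidirect_def act_mult act_comp P.m_assoc Q.m_assoc)

end

text \<open>
  Bijectivity of each \<open>\<theta> x\<close> comes for free: \<open>\<theta>\<close> of the inverse of \<open>x\<close> inverts it.
\<close>

lemma hom_AutoGroupI: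
  fixes \<theta> :: "'b \<Rightarrow> 'a \<Rightarrow> 'a"
  assumes "group P" and "group Q"
    and ext: "\<And>x. x \<in> carrier Q \<Longrightarrow> \<theta> x \<in> extensional (carrier P)"
    and hom: "\<And>x. x \<in> carrier Q \<Longrightarrow> \<theta> x \<in> hom P P"
    and one: "\<And>a. a \<in> carrier P \<Longrightarrow> \<theta> \<one>\<^bsub>Q\<^esub> a = a"
    and comp: "\<And>x y a. x \<in> carrier Q \<Longrightarrow> y \<in> carrier Q \<Longrightarrow> a \<in> carrier P \<Longrightarrow>
                 \<theta> (x \<otimes>\<^bsub>Q\<^esub> y) a = \<theta> x (\<theta> y a)"
  shows "\<theta> \<in> hom Q (AutoGroup P)"
proof -
  interpret P: group P by fact
  interpret Q: group Q by fact
  have auto: "\<theta> x \<in> auto P" if x: "x \<in> carrier Q" for x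
  proof -
    have cl: "\<theta> y a \<in> carrier P" if "y \<in> carrier Q" "a \<in> carrier P" for y a
      using hom that by (auto simp: hom_def)
    have "bij_betw (\<theta> x) (carrier P) (carrier P)"
      using x cl one comp[of "inv\<^bsub>Q\<^esub> x" x] comp[of x "inv\<^bsub>Q\<^esub> x"]
      by (intro bij_betw_byWitness[where f' = "\<theta> (inv\<^bsub>Q\<^esub> x)"]) auto
    then show ?thesis using x ext hom by (auto simp: auto_def Bij_def)
  qed
  show ?thesis
  proof (rule homI)
    fix x y assume xy: "x \<in> carrier Q" "y \<in> carrier Q"
    have "\<theta> (x \<otimes>\<^bsub>Q\<^esub> y) = compose (carrier P) (\<theta> x) (\<theta> y)"
      using xy ext comp by (intro extensionalityI[of _ "carrier P"]) (auto simp: compose_def)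
    then show "\<theta> (x \<otimes>\<^bsub>Q\<^esub> y) = \<theta> x \<otimes>\<^bsub>AutoGroup P\<^esub> \<theta> y"
      using xy auto by (simp add: AutoGroup_simps)
  qed (auto simp: AutoGroup_simps auto)
qed

lemma order_semidirect: "order (semidirect P Q \<theta>) = order P * order Q"
  by (simp add: semidirect_def order_def card_cartesian_product)

text \<open>
  Functoriality of the semidirect product in its normal factor, for equivariant homomorphisms.
\<close>

lemma semidirect_map_group_hom:
  fixes P :: "('a, 'm) monoid_scheme" and P' :: "('c, 'k) monoid_scheme"
  assumes "action_by_automorphisms P Q \<theta>" and "action_by_automorphisms P' Q \<theta>'"
    and f: "f \<in> hom P P'"
    and equi: "\<And>x a. x \<in> carrier Q \<Longrightarrow> a \<in> carrier P \<Longrightarrow> f (\<theta> x a) = \<theta>' x (f a)"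
  shows "group_hom (semidirect P Q \<theta>) (semidirect P' Q \<theta>') (map_prod f id)"
proof -
  interpret A: action_by_automorphisms P Q \<theta> by fact
  interpret A': action_by_automorphisms P' Q \<theta>' by fact
  have "map_prod f id \<in> hom (semidirect P Q \<theta>) (semidirect P' Q \<theta>')"
    using f by (auto simp: hom_def semidirect_def equi)
  then show ?thesis
    by (simp add: group_hom_def group_hom_axioms_def A.group_semidirect A'.group_semidirect)
qed

lemma semidirect_nat_pow:
  fixes n :: nat
  assumes "action_by_automorphisms P Q \<theta>" "a \<in> carrier P"
  shows "(a, \<one>\<^bsub>Q\<^esub>) [^]\<^bsub>semidirect P Q \<theta>\<^esub> n = (a [^]\<^bsub>P\<^esub> n, \<one>\<^bsub>Q\<^esub>)"
proof -
  interpret A: action_by_automorphisms P Q \<theta> by fact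
  show ?thesis using assms(2) by (induction n) (auto simp: semidirect_def)
qed

lemma semidirect_cong_iso:
  assumes "\<And>x a. x \<in> carrier Q \<Longrightarrow> a \<in> carrier P \<Longrightarrow> \<theta> x a = \<theta>' x a"
  shows "semidirect P Q \<theta> \<cong> semidirect P Q \<theta>'"
proof -
  have "id \<in> iso (semidirect P Q \<theta>) (semidirect P Q \<theta>')"
    using assms by (auto simp: iso_def hom_def semidirect_def bij_betw_def)
  then show ?thesis by (auto simp: is_iso_def)
qed


section \<open>Counting isomorphism classes\<close>

definition iso_rel :: "'a monoid set \<Rightarrow> ('a monoid \<times> 'a monoid) set" where
  "iso_rel S = {(G, H) \<in> S \<times> S. G \<cong> H}"

lemma equiv_iso_rel:
  assumes "\<And>G. G \<in> S \<Longrightarrow> group G"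
  shows "equiv S (iso_rel S)"
  using assms by (auto simp: iso_rel_def intro!: equivI refl_onI symI transI
      intro: iso_refl group.iso_sym iso_trans)

lemma group_split_extension:
  assumes "group P" "group Q" "G \<in> split_extensions P Q"
  shows "group G"
  using assms by (auto simp: split_extensions_def action_by_automorphisms_def
      action_by_automorphisms_axioms_def intro!: action_by_automorphisms.group_semidirect)

lemma num_iso_classes_split_extensions:
  assumes "n = order P * order Q"
  shows "num_iso_classes (split_extensions P Q) n
           = card (split_extensions P Q // iso_rel (split_extensions P Q))"
proof -
  have "{G \<in> split_extensions P Q. order G = n} = split_extensions P Q"
    using assms by (auto simp: split_extensions_def order_semidirect)
  then show ?thesis by (simp only: num_iso_classes_def iso_rel_def Let_def)
qed

text \<open>
  The set of extensions itself may be infinite, because \<open>\<theta>\<close> is arbitrary outside \<open>carrier Q\<close>; but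
  each class has a representative whose \<open>\<theta>\<close> is extensional, and there are finitely many of these.
  Finiteness matters since \<open>card\<close> of an infinite set is \<open>0\<close>, which would break the lower bound.
\<close>

lemma finite_iso_classes:
  assumes P: "group P" "finite (carrier P)" and Q: "group Q" "finite (carrier Q)"
  defines "S \<equiv> split_extensions P Q"
  shows "finite (S // iso_rel S)"
proof -
  let ?T = "carrier Q \<rightarrow>\<^sub>E (carrier P \<rightarrow>\<^sub>E carrier P)"
  have eq: "equiv S (iso_rel S)"
    unfolding S_def by (rule equiv_iso_rel) (rule group_split_extension[OF P(1) Q(1)])
  have "S // iso_rel S \<subseteq> (\<lambda>\<theta>. iso_rel S `` {semidirect P Q \<theta>}) ` ?T"
  proof
    fix C assume "C \<in> S // iso_rel S"
    then obtain \<theta> where \<theta>: "\<theta> \<in> hom Q (AutoGroup P)" "C = iso_rel S `` {semidirect P Q \<theta>}"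
      by (auto simp: quotient_def S_def split_extensions_def)
    interpret A: action_by_automorphisms P Q \<theta>
      using P Q \<theta> by (simp add: action_by_automorphisms_def action_by_automorphisms_axioms_def)
    let ?\<theta>' = "restrict \<theta> (carrier Q)"
    have hom': "?\<theta>' \<in> hom Q (AutoGroup P)"
      using \<theta>(1) by (auto simp: hom_def A.Q.m_closed)
    have "semidirect P Q \<theta> \<cong> semidirect P Q ?\<theta>'"
      by (rule semidirect_cong_iso) simp
    then have "(semidirect P Q \<theta>, semidirect P Q ?\<theta>') \<in> iso_rel S"
      using \<theta>(1) hom' by (auto simp: iso_rel_def S_def split_extensions_def)
    then have "C = iso_rel S `` {semidirect P Q ?\<theta>'}"
      using \<theta>(2) equiv_class_eq[OF eq] by metis
    moreover have "?\<theta>' \<in> ?T"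
      using A.act_auto by (auto simp: auto_def Bij_def PiE_def hom_def)
    ultimately show "C \<in> (\<lambda>\<theta>. iso_rel S `` {semidirect P Q \<theta>}) ` ?T" by blast
  qed
  moreover have "finite ?T" using P Q by (intro finite_PiE) auto
  ultimately show ?thesis using finite_surj by blast
qed


section \<open>Abelian groups as products of subgroups of coprime orders\<close>

lemma (in group) pow_cong_order:
  assumes "x \<in> carrier G" "[m = n] (mod order G)"
  shows "x [^] (m::nat) = x [^] n"
proof -
  have *: "x [^] (n + q * order G) = x [^] n" for q n :: nat
    using assms(1) by (simp add: pow_order_eq_1 flip: nat_pow_mult nat_pow_pow mult.commute[of "order G"])
  from assms(2) obtain q1 q2 where "m + q1 * order G = n + q2 * order G"
    by (metis cong_iff_lin_nat)
  then show ?thesis using * by metis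
qed

lemma (in group) eq_one_of_coprime_order:
  assumes "x \<in> carrier G" "x [^] (m::nat) = \<one>" "coprime m (order G)"
  shows "x = \<one>"
proof -
  have "ord x dvd m" "ord x dvd order G"
    using assms pow_eq_id ord_dvd_group_order by auto
  then have "ord x = 1" using assms(3) by (metis coprime_common_divisor nat_dvd_1_iff_1)
  then show ?thesis using assms(1) ord_eq_1 by simp
qed

text \<open>
  In the quotient by \<open>H\<close>, a group of order \<open>m\<close>, every \<open>m\<close>-th power is trivial.
\<close>

lemma (in comm_group) pow_index_mem_subgroup:
  assumes "subgroup H G" "order G = card H * m" "finite (carrier G)" "x \<in> carrier G"
  shows "x [^] m \<in> H"
proof -
  interpret H: normal H G using assms(1) by (rule subgroup_imp_normal)
  interpret F: group "G Mod H" by (rule H.factorgroup_is_group)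
  interpret h: group_hom G "G Mod H" "\<lambda>a. H #> a"
    using H.r_coset_hom_Mod by (simp add: group_hom_def group_hom_axioms_def F.is_group is_group)
  have "card H > 0"
    using assms(1,3) H.one_closed H.subset by (metis card_gt_0_iff empty_iff finite_subset)
  then have "order (G Mod H) = m"
    using lagrange[OF assms(1)] assms(2) by (simp add: order_def FactGroup_def)
  then have "H #> (x [^] m) = \<one>\<^bsub>G Mod H\<^esub>"
    using h.hom_nat_pow[OF assms(4), of m] F.pow_order_eq_1[of "H #> x"] h.hom_closed[OF assms(4)] by simp
  then have "H #> (x [^] m) = H" by (simp add: FactGroup_def)
  then show ?thesis
    using rcos_self[OF _ assms(1), of "x [^] m"] assms(4) by auto
qed

definition torsion :: "nat \<Rightarrow> ('a, 'm) monoid_scheme \<Rightarrow> 'a set" where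
  "torsion m G = {g \<in> carrier G. g [^]\<^bsub>G\<^esub> m = \<one>\<^bsub>G\<^esub>}"

text \<open>
  The set \<open>torsion m G\<close> is preserved by isomorphisms, so an epimorphic image of \<open>G\<close> whose kernel has
  this form depends, up to isomorphism, only on \<open>m\<close> and the isomorphism class of \<open>G\<close>.
\<close>

lemma torsion_quotient_iso:
  assumes f: "group_hom G K f" "f ` carrier G = carrier K" "kernel G K f = torsion m G"
    and f': "group_hom G' K' f'" "f' ` carrier G' = carrier K'" "kernel G' K' f' = torsion m G'"
    and iso: "G \<cong> G'"
  shows "K \<cong> K'"
proof -
  interpret f: group_hom G K f by fact
  interpret f': group_hom G' K' f' by fact
  obtain h where h: "h \<in> iso G G'" using iso by (auto simp: is_iso_def)
  interpret h: group_hom G G' h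
    using h by unfold_locales (simp add: iso_def)
  have bij: "bij_betw h (carrier G) (carrier G')" using h by (simp add: iso_def)
  interpret g: group_hom G K' "f' \<circ> h"
    using hom_compose[OF h.homh f'.homh] by unfold_locales
  have surj: "(f' \<circ> h) ` carrier G = carrier K'"
    using bij f'(2) by (metis bij_betw_def image_comp)
  have tors: "h x \<in> torsion m G' \<longleftrightarrow> x \<in> torsion m G" if x: "x \<in> carrier G" for x
  proof -
    have "h x [^]\<^bsub>G'\<^esub> m = h (x [^]\<^bsub>G\<^esub> m)" using x by (simp add: h.hom_nat_pow)
    also have "\<dots> = \<one>\<^bsub>G'\<^esub> \<longleftrightarrow> x [^]\<^bsub>G\<^esub> m = \<one>\<^bsub>G\<^esub>"
      using bij x inj_on_eq_iff[of h "carrier G" "x [^]\<^bsub>G\<^esub> m" "\<one>\<^bsub>G\<^esub>"] by (simp add: bij_betw_def)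
    finally show ?thesis using x by (simp add: torsion_def)
  qed
  have "kernel G K' (f' \<circ> h) = {x \<in> carrier G. h x \<in> kernel G' K' f'}"
    by (auto simp: kernel_def)
  also have "\<dots> = torsion m G"
    using tors by (auto simp: f'(3)) (auto simp: torsion_def)
  finally have "G Mod torsion m G \<cong> K'" using g.FactGroup_iso[OF surj] by simp
  moreover have "G Mod torsion m G \<cong> K"
    using f.FactGroup_iso[OF f(2)] by (simp only: f(3))
  moreover have "group (G Mod torsion m G)"
    using normal.factorgroup_is_group[OF f.normal_kernel] by (simp only: f(3))
  ultimately show ?thesis
    using group.iso_sym iso_trans by blast
qed

locale coprime_subgroups = comm_group P
  for P :: "('a, 'm) monoid_scheme" (structure) +
  fixes I :: "'i set" and H :: "'i \<Rightarrow> 'a set"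
  assumes finite_carrier: "finite (carrier P)"
    and finite_index: "finite I"
    and sub: "i \<in> I \<Longrightarrow> subgroup (H i) P"
    and coprime_cards: "i \<in> I \<Longrightarrow> j \<in> I \<Longrightarrow> i \<noteq> j \<Longrightarrow> coprime (card (H i)) (card (H j))"
    and order_eq: "order P = (\<Prod>i\<in>I. card (H i))"
begin

lemma group_factor: "i \<in> I \<Longrightarrow> group (P\<lparr>carrier := H i\<rparr>)"
  using sub by (rule subgroup.subgroup_is_group[OF _ is_group])

lemma factor_closed: "i \<in> I \<Longrightarrow> a \<in> H i \<Longrightarrow> a \<in> carrier P"
  using sub subgroup.mem_carrier by metis

definition cofactor :: "'i \<Rightarrow> nat" where
  "cofactor i = (\<Prod>j\<in>I - {i}. card (H j))"

lemma order_eq_cofactor: "i \<in> I \<Longrightarrow> order P = card (H i) * cofactor i"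
  by (simp add: order_eq cofactor_def prod.remove[OF finite_index])

lemma coprime_cofactor: "i \<in> I \<Longrightarrow> coprime (cofactor i) (card (H i))"
  unfolding cofactor_def by (rule prod_coprime_left) (auto intro: coprime_cards)

lemma card_dvd_cofactor: "j \<in> I \<Longrightarrow> j \<noteq> i \<Longrightarrow> card (H j) dvd cofactor i"
  unfolding cofactor_def using finite_index by (intro dvd_prodI) auto

text \<open>
  The weights are the idempotents of the Chinese remainder theorem: congruent to \<open>1\<close> modulo the order
  of one factor and to \<open>0\<close> modulo the orders of the others. Raising to the power \<open>weight i\<close> is
  therefore the projection of \<open>P\<close> to \<open>H i\<close>.
\<close>

definition weight :: "'i \<Rightarrow> nat" where
  "weight i = cofactor i * (SOME x. [cofactor i * x = 1] (mod card (H i)))"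

lemma cofactor_dvd_weight: "cofactor i dvd weight i"
  by (simp add: weight_def)

lemma weight_cong_1: "i \<in> I \<Longrightarrow> [weight i = 1] (mod card (H i))"
  unfolding weight_def using someI_ex[OF cong_solve_coprime_nat[OF coprime_cofactor]] by simp

lemma weight_cong_0: "j \<in> I \<Longrightarrow> j \<noteq> i \<Longrightarrow> [weight i = 0] (mod card (H j))"
  using card_dvd_cofactor cofactor_dvd_weight by (simp add: cong_0_iff) (metis dvd_trans)

lemma sum_weights_cong: "[(\<Sum>i\<in>I. weight i) = 1] (mod order P)"
  unfolding order_eq
proof (rule coprime_cong_prod_nat)
  fix j assume j: "j \<in> I"
  have "[(\<Sum>i\<in>I - {j}. weight i) = (\<Sum>i\<in>I - {j}. 0)] (mod card (H j))"
    using j by (intro cong_sum weight_cong_0) auto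
  then have "[weight j + (\<Sum>i\<in>I - {j}. weight i) = 1 + 0] (mod card (H j))"
    using weight_cong_1[OF j] by (intro cong_add) auto
  then show "[(\<Sum>i\<in>I. weight i) = 1] (mod card (H j))"
    using j by (simp add: sum.remove[OF finite_index])
qed (auto intro: coprime_cards)

definition proj :: "'i \<Rightarrow> 'a \<Rightarrow> 'a" where
  "proj i a = a [^] weight i"

lemma proj_closed [simp]: "a \<in> carrier P \<Longrightarrow> proj i a \<in> carrier P"
  by (simp add: proj_def)

lemma proj_mem:
  assumes "i \<in> I" "a \<in> carrier P" shows "proj i a \<in> H i"
proof -
  obtain t where "weight i = t * cofactor i"
    using cofactor_dvd_weight[of i] by (metis dvdE mult.commute)
  then have "proj i a = (a [^] t) [^] cofactor i"
    using assms by (simp add: proj_def nat_pow_pow)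
  then show ?thesis
    using pow_index_mem_subgroup[OF sub[OF assms(1)] order_eq_cofactor[OF assms(1)] finite_carrier] assms
    by simp
qed

lemma pow_cong_factor:
  assumes "i \<in> I" "a \<in> H i" "[m = n] (mod card (H i))"
  shows "a [^] (m::nat) = a [^] n"
proof -
  have "a [^]\<^bsub>P\<lparr>carrier := H i\<rparr>\<^esub> m = a [^]\<^bsub>P\<lparr>carrier := H i\<rparr>\<^esub> n"
    using assms by (intro group.pow_cong_order[OF group_factor]) (auto simp: order_def)
  then show ?thesis by (simp flip: nat_pow_consistent)
qed

lemma proj_factor:
  assumes "i \<in> I" "j \<in> I" "a \<in> H j"
  shows "proj i a = (if i = j then a else \<one>)"
proof -
  have "a \<in> carrier P" using assms factor_closed by simp
  then show ?thesis
    using pow_cong_factor[OF assms(2,3), of "weight i" 1] weight_cong_1[OF assms(1)]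
      pow_cong_factor[OF assms(2,3), of "weight i" 0] weight_cong_0[OF assms(2), of i]
    by (auto simp: proj_def)
qed

lemma proj_mult:
  "a \<in> carrier P \<Longrightarrow> b \<in> carrier P \<Longrightarrow> proj i (a \<otimes> b) = proj i a \<otimes> proj i b"
  by (simp add: proj_def nat_pow_distrib)

lemma proj_hom: "i \<in> I \<Longrightarrow> proj i \<in> hom P (P\<lparr>carrier := H i\<rparr>)"
  by (auto simp: hom_def proj_mem proj_mult)

lemma proj_finprod:
  assumes "i \<in> I" "\<And>j. j \<in> I \<Longrightarrow> f j \<in> H j"
  shows "proj i (\<Otimes>j\<in>I. f j) = f i"
proof -
  have *: "proj i (\<Otimes>j\<in>J. f j) = (\<Otimes>j\<in>J. proj i (f j))" if "J \<subseteq> I" for J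
    using finite_subset[OF that finite_index] that
  proof (induction J rule: finite_induct)
    case empty
    then show ?case by (simp add: proj_def)
  next
    case (insert j J)
    then have "f \<in> J \<rightarrow> carrier P" "f j \<in> carrier P"
      using assms(2) factor_closed by (auto simp: subset_iff)
    then show ?case using insert by (simp add: Pi_iff proj_mult)
  qed
  have "(\<Otimes>j\<in>I. proj i (f j)) = (\<Otimes>j\<in>I. if i = j then f j else \<one>)"
    using assms factor_closed by (intro finprod_cong) (auto simp: proj_factor simp_implies_def)
  also have "\<dots> = f i"
    using assms factor_closed finite_index by (intro finprod_singleton) auto
  finally show ?thesis using * by simp
qed

text \<open>
  The product is the power of \<open>a\<close> by the sum of all weights, which is \<open>1\<close> modulo the order of \<open>P\<close>.
\<close>

lemma finprod_proj:
  assumes "a \<in> carrier P" shows "(\<Otimes>i\<in>I. proj i a) = a"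
proof -
  have "(\<Otimes>i\<in>J. proj i a) = a [^] (\<Sum>i\<in>J. weight i)" if "finite J" for J
    using that assms by (induction J rule: finite_induct) (auto simp: proj_def nat_pow_mult Pi_iff)
  then show ?thesis
    using finite_index pow_cong_order[OF assms sum_weights_cong] assms by simp
qed

text \<open>
  Restricting to \<open>carrier P\<close> makes each \<open>glue \<theta> x\<close> extensional, as membership in \<open>auto P\<close> demands.
\<close>

definition glue :: "('i \<Rightarrow> 'b \<Rightarrow> 'a \<Rightarrow> 'a) \<Rightarrow> 'b \<Rightarrow> 'a \<Rightarrow> 'a" where
  "glue \<theta> x = (\<lambda>a\<in>carrier P. \<Otimes>i\<in>I. \<theta> i x (proj i a))"

context
  fixes Q :: "('b, 'n) monoid_scheme" and \<theta> :: "'i \<Rightarrow> 'b \<Rightarrow> 'a \<Rightarrow> 'a"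
  assumes group_Q: "group Q"
    and acts: "\<And>i. i \<in> I \<Longrightarrow> \<theta> i \<in> hom Q (AutoGroup (P\<lparr>carrier := H i\<rparr>))"
begin

lemma factor_action: "i \<in> I \<Longrightarrow> action_by_automorphisms (P\<lparr>carrier := H i\<rparr>) Q (\<theta> i)"
  by (simp add: action_by_automorphisms_def action_by_automorphisms_axioms_def
      group_Q acts group_factor)

lemma factor_act_mem: "i \<in> I \<Longrightarrow> x \<in> carrier Q \<Longrightarrow> a \<in> H i \<Longrightarrow> \<theta> i x a \<in> H i"
  using action_by_automorphisms.act_closed[OF factor_action] by fastforce

lemma factor_act_carrier:
  "i \<in> I \<Longrightarrow> x \<in> carrier Q \<Longrightarrow> a \<in> carrier P \<Longrightarrow> \<theta> i x (proj i a) \<in> carrier P"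
  using factor_closed factor_act_mem proj_mem by metis

text \<open>
  This equivariance of the projections makes the glued action multiplicative in \<open>x\<close>, and lets
  \<open>proj i\<close> extend to a homomorphism of the semidirect products.
\<close>

lemma proj_glue:
  assumes "i \<in> I" "x \<in> carrier Q" "a \<in> carrier P"
  shows "proj i (glue \<theta> x a) = \<theta> i x (proj i a)"
  using assms by (simp add: glue_def proj_finprod factor_act_mem proj_mem)

lemma glue_closed: "x \<in> carrier Q \<Longrightarrow> a \<in> carrier P \<Longrightarrow> glue \<theta> x a \<in> carrier P"
  by (auto simp: glue_def factor_act_carrier intro!: finprod_closed)

lemma glue_in_hom: "glue \<theta> \<in> hom Q (AutoGroup P)"
proof (rule hom_AutoGroupI)
  fix x assume x: "x \<in> carrier Q"
  show "glue \<theta> x \<in> hom P P"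
  proof (rule homI)
    fix a b assume ab: "a \<in> carrier P" "b \<in> carrier P"
    have "(\<Otimes>i\<in>I. \<theta> i x (proj i (a \<otimes> b))) = (\<Otimes>i\<in>I. \<theta> i x (proj i a) \<otimes> \<theta> i x (proj i b))"
      using x ab action_by_automorphisms.act_mult[OF factor_action]
      by (intro finprod_cong) (auto simp: proj_mult proj_mem factor_act_carrier simp_implies_def)
    also have "\<dots> = (\<Otimes>i\<in>I. \<theta> i x (proj i a)) \<otimes> (\<Otimes>i\<in>I. \<theta> i x (proj i b))"
      using x ab by (intro finprod_multf) (auto simp: factor_act_carrier)
    finally show "glue \<theta> x (a \<otimes> b) = glue \<theta> x a \<otimes> glue \<theta> x b"
      using ab by (simp add: glue_def)
  qed (use x glue_closed in auto)
next
  fix a assume a: "a \<in> carrier P"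
  have "(\<Otimes>i\<in>I. \<theta> i \<one>\<^bsub>Q\<^esub> (proj i a)) = (\<Otimes>i\<in>I. proj i a)"
    using a action_by_automorphisms.act_one[OF factor_action]
    by (intro finprod_cong) (auto simp: proj_mem simp_implies_def)
  then show "glue \<theta> \<one>\<^bsub>Q\<^esub> a = a" using a by (simp add: glue_def finprod_proj)
next
  fix x y a assume xy: "x \<in> carrier Q" "y \<in> carrier Q" and a: "a \<in> carrier P"
  have eq: "\<theta> i (x \<otimes>\<^bsub>Q\<^esub> y) (proj i a) = \<theta> i x (proj i (glue \<theta> y a))" if "i \<in> I" for i
    using xy a that action_by_automorphisms.act_comp[OF factor_action[OF that]]
    by (simp add: proj_mem proj_glue)
  have "(\<Otimes>i\<in>I. \<theta> i (x \<otimes>\<^bsub>Q\<^esub> y) (proj i a)) = (\<Otimes>i\<in>I. \<theta> i x (proj i (glue \<theta> y a)))"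
    using xy a by (intro finprod_cong) (auto simp: eq factor_act_carrier glue_closed simp_implies_def)
  then show "glue \<theta> (x \<otimes>\<^bsub>Q\<^esub> y) a = glue \<theta> x (glue \<theta> y a)"
    using a glue_closed[OF xy(2) a] by (simp add: glue_def[of _ x] glue_def[of _ "x \<otimes>\<^bsub>Q\<^esub> y"])
qed (auto simp: glue_def group_Q is_group)

lemma glue_action: "action_by_automorphisms P Q (glue \<theta>)"
  by (simp add: action_by_automorphisms_def action_by_automorphisms_axioms_def
      group_Q glue_in_hom is_group)

lemma semidirect_proj_group_hom:
  assumes "i \<in> I"
  shows "group_hom (semidirect P Q (glue \<theta>)) (semidirect (P\<lparr>carrier := H i\<rparr>) Q (\<theta> i)) (map_prod (proj i) id)"
  using assms
  by (intro semidirect_map_group_hom[OF glue_action factor_action[OF assms] proj_hom]) (auto simp: proj_glue)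

lemma semidirect_proj_surj:
  assumes i: "i \<in> I"
  shows "map_prod (proj i) id ` carrier (semidirect P Q (glue \<theta>))
           = carrier (semidirect (P\<lparr>carrier := H i\<rparr>) Q (\<theta> i))"
proof -
  have "proj i ` carrier P = H i"
    using i proj_mem factor_closed proj_factor[OF i i] by (force simp: image_iff)
  then show ?thesis by (simp add: semidirect_def map_prod_surj_on)
qed

text \<open>
  An element killed by \<open>cofactor i\<close> has an image in a group of order coprime to \<open>cofactor i\<close>, so that
  image is trivial. Conversely, kernel elements lie in \<open>P\<close> and satisfy \<open>a [^] weight i = \<one>\<close>; as
  \<open>weight i\<close> is \<open>1\<close> modulo \<open>card (H i)\<close>, multiplying by \<open>cofactor i\<close> shows that \<open>a [^] cofactor i\<close>
  is a power of \<open>a [^] weight i\<close>.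
\<close>

lemma semidirect_proj_kernel:
  assumes cop: "coprime (order P) (order Q)" and i: "i \<in> I"
  defines "G \<equiv> semidirect P Q (glue \<theta>)" and "G' \<equiv> semidirect (P\<lparr>carrier := H i\<rparr>) Q (\<theta> i)"
  shows "kernel G G' (map_prod (proj i) id) = torsion (cofactor i) G" (is "kernel G G' ?\<pi> = _")
proof -
  interpret \<pi>: group_hom G G' ?\<pi>
    unfolding G_def G'_def by (rule semidirect_proj_group_hom[OF i])
  show ?thesis
  proof (intro equalityI subsetI)
    fix g assume "g \<in> kernel G G' ?\<pi>"
    then obtain a where a: "g = (a, \<one>\<^bsub>Q\<^esub>)" "a \<in> carrier P" "proj i a = \<one>" and g: "g \<in> carrier G"
      by (auto simp: kernel_def G_def G'_def semidirect_def)
    have "[1 * cofactor i = weight i * cofactor i] (mod card (H i) * cofactor i)"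
      using weight_cong_1[OF i] unfolding cong_def by (metis mult_mod_left)
    then have "a [^] cofactor i = a [^] (weight i * cofactor i)"
      using a(2) i by (intro pow_cong_order) (simp_all add: order_eq_cofactor)
    also have "\<dots> = \<one>" using a(2,3) by (simp add: proj_def flip: nat_pow_pow)
    finally have "g [^]\<^bsub>G\<^esub> cofactor i = \<one>\<^bsub>G\<^esub>"
      using a by (simp add: G_def semidirect_nat_pow[OF glue_action]) (simp add: semidirect_def)
    then show "g \<in> torsion (cofactor i) G" using g by (simp add: torsion_def)
  next
    fix g assume "g \<in> torsion (cofactor i) G"
    then have g: "g \<in> carrier G" "g [^]\<^bsub>G\<^esub> cofactor i = \<one>\<^bsub>G\<^esub>" by (auto simp: torsion_def)
    have "coprime (cofactor i) (order G')"
      using cop coprime_cofactor[OF i] order_eq_cofactor[OF i]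
      by (simp add: G'_def order_semidirect) (simp add: order_def)
    moreover have "?\<pi> g [^]\<^bsub>G'\<^esub> cofactor i = \<one>\<^bsub>G'\<^esub>"
      using g(2) \<pi>.hom_nat_pow[OF g(1), of "cofactor i"] \<pi>.hom_one by metis
    ultimately have "?\<pi> g = \<one>\<^bsub>G'\<^esub>"
      using \<pi>.H.eq_one_of_coprime_order \<pi>.hom_closed[OF g(1)] by blast
    then show "g \<in> kernel G G' ?\<pi>" using g by (simp add: kernel_def)
  qed
qed

end

lemma factor_iso_of_glue_iso:
  fixes Q :: "('b, 'n) monoid_scheme"
  assumes "group Q" "coprime (order P) (order Q)" "i \<in> I"
    and "\<And>i. i \<in> I \<Longrightarrow> \<theta> i \<in> hom Q (AutoGroup (P\<lparr>carrier := H i\<rparr>))"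
    and "\<And>i. i \<in> I \<Longrightarrow> \<theta>' i \<in> hom Q (AutoGroup (P\<lparr>carrier := H i\<rparr>))"
    and "semidirect P Q (glue \<theta>) \<cong> semidirect P Q (glue \<theta>')"
  shows "semidirect (P\<lparr>carrier := H i\<rparr>) Q (\<theta> i) \<cong> semidirect (P\<lparr>carrier := H i\<rparr>) Q (\<theta>' i)"
proof (rule torsion_quotient_iso[OF _ _ _ _ _ _ assms(6)])
  note Q = assms(1) and cop = assms(2) and i = assms(3) and acts = assms(4) and acts' = assms(5)
  show "group_hom (semidirect P Q (glue \<theta>)) (semidirect (P\<lparr>carrier := H i\<rparr>) Q (\<theta> i)) (map_prod (proj i) id)"
    by (rule semidirect_proj_group_hom[OF Q acts i])
  show "map_prod (proj i) id ` carrier (semidirect P Q (glue \<theta>)) = carrier (semidirect (P\<lparr>carrier := H i\<rparr>) Q (\<theta> i))"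
    by (rule semidirect_proj_surj[OF Q acts i])
  show "kernel (semidirect P Q (glue \<theta>)) (semidirect (P\<lparr>carrier := H i\<rparr>) Q (\<theta> i)) (map_prod (proj i) id)
          = torsion (cofactor i) (semidirect P Q (glue \<theta>))"
    by (rule semidirect_proj_kernel[OF Q acts cop i])
  show "group_hom (semidirect P Q (glue \<theta>')) (semidirect (P\<lparr>carrier := H i\<rparr>) Q (\<theta>' i)) (map_prod (proj i) id)"
    by (rule semidirect_proj_group_hom[OF Q acts' i])
  show "map_prod (proj i) id ` carrier (semidirect P Q (glue \<theta>')) = carrier (semidirect (P\<lparr>carrier := H i\<rparr>) Q (\<theta>' i))"
    by (rule semidirect_proj_surj[OF Q acts' i])
  show "kernel (semidirect P Q (glue \<theta>')) (semidirect (P\<lparr>carrier := H i\<rparr>) Q (\<theta>' i)) (map_prod (proj i) id)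
          = torsion (cofactor i) (semidirect P Q (glue \<theta>'))"
    by (rule semidirect_proj_kernel[OF Q acts' cop i])
qed

theorem prod_num_iso_classes_le:
  fixes Q :: "('b, 'n) monoid_scheme"
  assumes Q: "group Q" "finite (carrier Q)" and cop: "coprime (order P) (order Q)"
  shows "(\<Prod>i\<in>I. num_iso_classes (split_extensions (P\<lparr>carrier := H i\<rparr>) Q) (card (H i) * order Q))
           \<le> num_iso_classes (split_extensions P Q) (order P * order Q)"
proof -
  let ?S = "split_extensions P Q" and ?T = "\<lambda>i. split_extensions (P\<lparr>carrier := H i\<rparr>) Q"
  have eqS: "equiv ?S (iso_rel ?S)"
    by (rule equiv_iso_rel) (rule group_split_extension[OF is_group Q(1)])
  have eqT: "equiv (?T i) (iso_rel (?T i))" if "i \<in> I" for i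
    by (rule equiv_iso_rel) (rule group_split_extension[OF group_factor[OF that] Q(1)])
  \<comment> \<open>a choice of an action on \<open>H i\<close> that represents the isomorphism class \<open>C\<close>\<close>
  define r where "r i C = (SOME \<theta>. \<theta> \<in> hom Q (AutoGroup (P\<lparr>carrier := H i\<rparr>)) \<and>
      C = iso_rel (?T i) `` {semidirect (P\<lparr>carrier := H i\<rparr>) Q \<theta>})" for i C
  have r: "r i C \<in> hom Q (AutoGroup (P\<lparr>carrier := H i\<rparr>))"
    "C = iso_rel (?T i) `` {semidirect (P\<lparr>carrier := H i\<rparr>) Q (r i C)}"
    if "C \<in> ?T i // iso_rel (?T i)" for i C
  proof -
    have "\<exists>\<theta>. \<theta> \<in> hom Q (AutoGroup (P\<lparr>carrier := H i\<rparr>)) \<and>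
      C = iso_rel (?T i) `` {semidirect (P\<lparr>carrier := H i\<rparr>) Q \<theta>}"
      using that by (auto simp: quotient_def split_extensions_def)
    from someI_ex[OF this, folded r_def]
    show "r i C \<in> hom Q (AutoGroup (P\<lparr>carrier := H i\<rparr>))"
      "C = iso_rel (?T i) `` {semidirect (P\<lparr>carrier := H i\<rparr>) Q (r i C)}" by auto
  qed
  let ?D = "\<Pi>\<^sub>E i\<in>I. ?T i // iso_rel (?T i)"
  define F where "F C = semidirect P Q (glue (\<lambda>i. r i (C i)))" for C
  have F: "F C \<in> ?S" if "C \<in> ?D" for C
  proof -
    have "glue (\<lambda>i. r i (C i)) \<in> hom Q (AutoGroup P)"
      by (rule glue_in_hom[OF Q(1)]) (rule r(1)[OF PiE_mem[OF that]])
    then show ?thesis by (auto simp: F_def split_extensions_def)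
  qed
  have "inj_on (\<lambda>C. iso_rel ?S `` {F C}) ?D"
  proof (rule inj_onI, rule PiE_ext)
    fix C C' i
    assume C: "C \<in> ?D" "C' \<in> ?D" and i: "i \<in> I" and "iso_rel ?S `` {F C} = iso_rel ?S `` {F C'}"
    then have "F C \<cong> F C'"
      using eq_equiv_class_iff[OF eqS F F] by (simp add: iso_rel_def)
    then have "semidirect (P\<lparr>carrier := H i\<rparr>) Q (r i (C i)) \<cong> semidirect (P\<lparr>carrier := H i\<rparr>) Q (r i (C' i))"
      unfolding F_def
      by (rule factor_iso_of_glue_iso[OF Q(1) cop i, rotated -1]) (intro r(1)[OF PiE_mem[OF C(1)]] r(1)[OF PiE_mem[OF C(2)]]; assumption)+
    then have rel: "(semidirect (P\<lparr>carrier := H i\<rparr>) Q (r i (C i)),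
        semidirect (P\<lparr>carrier := H i\<rparr>) Q (r i (C' i))) \<in> iso_rel (?T i)"
      using r(1)[OF PiE_mem[OF C(1) i]] r(1)[OF PiE_mem[OF C(2) i]]
      by (auto simp: iso_rel_def split_extensions_def)
    have "C i = iso_rel (?T i) `` {semidirect (P\<lparr>carrier := H i\<rparr>) Q (r i (C i))}"
      by (rule r(2)[OF PiE_mem[OF C(1) i]])
    also have "\<dots> = iso_rel (?T i) `` {semidirect (P\<lparr>carrier := H i\<rparr>) Q (r i (C' i))}"
      by (rule equiv_class_eq[OF eqT[OF i] rel])
    also have "\<dots> = C' i"
      by (rule r(2)[OF PiE_mem[OF C(2) i], symmetric])
    finally show "C i = C' i" .
  qed auto
  moreover have "(\<lambda>C. iso_rel ?S `` {F C}) ` ?D \<subseteq> ?S // iso_rel ?S"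
    using F by (auto intro!: quotientI)
  moreover have "finite (?S // iso_rel ?S)"
    by (rule finite_iso_classes[OF is_group finite_carrier Q])
  ultimately have "card ?D \<le> card (?S // iso_rel ?S)"
    by (rule card_inj_on_le)
  then show ?thesis
    by (simp add: card_PiE[OF finite_index] num_iso_classes_split_extensions order_def)
qed

end


section \<open>Products of two cyclic groups\<close>

lemma order_integer_mod_group:
  "n > 0 \<Longrightarrow> order (integer_mod_group n) = n"
  by (simp add: order_def carrier_integer_mod_group)

lemma order_DirProd: "order (G \<times>\<times> H) = order G * order H"
  by (simp add: order_def DirProd_def card_cartesian_product)

lemma comm_group_DirProd:
  assumes "comm_group G" "comm_group H"
  shows "comm_group (G \<times>\<times> H)"
proof -
  interpret G: comm_group G by fact
  interpret H: comm_group H by fact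
  show ?thesis
    by (rule group.group_comm_groupI) (auto simp: DirProd_group G.m_comm H.m_comm)
qed

theorem corollary1p4:
  fixes a b c d k :: nat and p \<alpha> :: "nat \<Rightarrow> nat" and P :: "nat \<Rightarrow> (int \<times> int) set"
  assumes "a > 0" "b > 0" "c > 0" "d > 0"
    and "odd a" "odd b" "odd c" "odd d"
    and "coprime a b" "coprime a c" "coprime a d" "coprime b c" "coprime b d" "coprime c d"
    and "squarefree b" "squarefree d"
    and "cube_free a" "cube_free c"
    and "bij_betw p {1..k} {q. prime q \<and> q dvd a * b}"
    and "\<And>i. i \<in> {1..k} \<Longrightarrow>
           sylow_subgroup (p i) (P i) (integer_mod_group (a * b) \<times>\<times> integer_mod_group b)"
    and "\<And>i. i \<in> {1..k} \<Longrightarrow> card (P i) = p i ^ \<alpha> i"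
  shows "num_iso_classes
           (split_extensions (integer_mod_group (a * b) \<times>\<times> integer_mod_group b)
                             (integer_mod_group (c * d) \<times>\<times> integer_mod_group d))
           (a * b ^ 2 * c * d ^ 2)
         \<ge> (\<Prod>i = 1..k.
              num_iso_classes
                (split_extensions
                  ((integer_mod_group (a * b) \<times>\<times> integer_mod_group b) \<lparr>carrier := P i\<rparr>)
                  (integer_mod_group (c * d) \<times>\<times> integer_mod_group d))
                (p i ^ \<alpha> i * c * d ^ 2))"
proof -
  let ?P = "integer_mod_group (a * b) \<times>\<times> integer_mod_group b"
  let ?Q = "integer_mod_group (c * d) \<times>\<times> integer_mod_group d"
  have oP: "order ?P = a * b ^ 2" and oQ: "order ?Q = c * d ^ 2"
    using assms(1-4) by (simp_all add: order_DirProd order_integer_mod_group power2_eq_square)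
  have pos: "order ?P > 0" "order ?Q > 0"
    using assms(1-4) by (simp_all add: oP oQ)
  have cP: "comm_group ?P" and gQ: "group ?Q"
    by (auto intro!: comm_group_DirProd abelian_integer_mod_group DirProd_group)
  have prime_p: "prime (p i)" if "i \<in> {1..k}" for i
    using that bij_betwE[OF assms(19)] by blast
  have inj_p: "inj_on p {1..k}" and img_p: "p ` {1..k} = prime_factors (order ?P)"
    using assms(19) pos assms(1,2)
    by (auto simp: bij_betw_def oP prime_factors_dvd prime_dvd_mult_iff prime_dvd_power_iff)
  have card_P: "card (P i) = p i ^ multiplicity (p i) (order ?P)" if "i \<in> {1..k}" for i
    using assms(20)[OF that] by (simp add: sylow_subgroup_def)
  interpret coprime_subgroups ?P "{1..k}" P
  proof (intro coprime_subgroups.intro coprime_subgroups_axioms.intro cP)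
    show "finite (carrier ?P)" using pos by (simp add: order_def card_gt_0_iff)
    show "subgroup (P i) ?P" if "i \<in> {1..k}" for i
      using assms(20)[OF that] by (simp add: sylow_subgroup_def)
    show "coprime (card (P i)) (card (P j))" if "i \<in> {1..k}" "j \<in> {1..k}" "i \<noteq> j" for i j
      using that prime_p inj_p
      by (auto simp: card_P intro!: primes_coprime dest: inj_onD)
    have "order ?P = (\<Prod>q\<in>p ` {1..k}. q ^ multiplicity q (order ?P))"
      unfolding img_p using pos by (intro prime_factorization_nat) auto
    also have "\<dots> = (\<Prod>i = 1..k. card (P i))"
      using inj_p by (simp add: prod.reindex card_P)
    finally show "order ?P = (\<Prod>i = 1..k. card (P i))" .
  qed simp
  have "coprime (order ?P) (order ?Q)"
    unfolding oP oQ using assms(9-14) by (simp add: coprime_commute)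
  moreover have "finite (carrier ?Q)" using pos by (simp add: order_def card_gt_0_iff)
  ultimately have "(\<Prod>i = 1..k. num_iso_classes (split_extensions (?P\<lparr>carrier := P i\<rparr>) ?Q) (card (P i) * order ?Q))
           \<le> num_iso_classes (split_extensions ?P ?Q) (order ?P * order ?Q)"
    by (intro prod_num_iso_classes_le[OF gQ])
  then show ?thesis
    by (simp add: oP oQ assms(21) mult.assoc)
qed

end
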